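(* Let $\mathcal{F}$ be an arbitrary family of finite subsets of $\mathbb{N}$, let $M$ be an infinite subset of $\mathbb{N}$ and let $\xi$ be a countable ordinal number. Then there exists an infinite subset $L$ of $M$ such that either $\mathcal{A}_\xi\cap[L]^{<\omega}\subseteq\mathcal{F}$ or $\mathcal{A}_\xi\cap[L]^{<\omega}\subseteq[\mathbb{N}]^{<\omega}\setminus\mathcal{F}$.
   Context: $\mathbb{N}=\{1,2,3,\dots\}$. For $M\subseteq\mathbb{N}$, $[M]^{<\omega}$ is the set of all finite subsets of $M$ (including $\emptyset$). For $s,t\subseteq\mathbb{N}$ nonempty, $s<t$ means $\max s<\min t$; $\{n\}<\emptyset$ is considered true. The complete thin Schreier system $(\mathcal{A}_\xi)_{\xi<\omega_1}$ of families of finite subsets of $\mathbb{N}$: for every non-zero countable limit ordinal $\lambda$ fix a strictly increasing sequence $(\lambda_n)_{n\ge1}$ of successor ordinals smaller than $\lambda$ with $\sup_n\lambda_n=\lambda$. Define recursively (here $p\,\omega^{\alpha}$ denotes the sum of $p$ copies of $\omega^\alpha$): (1) $\mathcal{A}_0=\{\emptyset\}$. (2) $\mathcal{A}_{\zeta+1}=\{\{n\}\cup s_1: n\in\mathbb{N},\ \{n\}<s_1,\ s_1\in\mathcal{A}_\zeta\}$. (3) $\mathcal{A}_{\omega^{\beta+1}}=\{\bigcup_{i=1}^n s_i: n=\min s_1,\ s_1<\dots<s_n,\ s_1,\dots,s_n\in\mathcal{A}_{\omega^\beta}\}$ for $\beta$ a countable ordinal. (4) $\mathcal{A}_{\omega^\lambda}=\{s: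 s\in\mathcal{A}_{\omega^{\lambda_n}}\text{ with }n=\min s\}$ for $\lambda$ a non-zero countable limit ordinal. (5) If $\xi$ is a limit ordinal with $\omega^\alpha<\xi<\omega^{\alpha+1}$ for some $0<\alpha<\omega_1$, write uniquely $\xi=p\,\omega^\alpha+\sum_{i=1}^m p_i\,\omega^{\alpha_i}$ with $m\ge0$, $\alpha>\alpha_1>\dots>\alpha_m>0$, natural numbers $p,p_1,\dots,p_m\ge1$ (either $p>1$, or $p=1$ and $m\ge1$). Then $\mathcal{A}_\xi$ is the family of all $s=s_0\cup\bigcup_{i=1}^m s_i$ with $s_m<\dots<s_1<s_0$, where $s_0=s^0_1\cup\dots\cup s^0_p$ with $s^0_1<\dots<s^0_p$ and all $s^0_j\in\mathcal{A}_{\omega^\alpha}$, and, for $1\le i\le m$, $s_i=s^i_1\cup\dots\cup s^i_{p_i}$ with $s^i_1<\dots<s^i_{p_i}$ and all $s^i_j\in\mathcal{A}_{\omega^{\alpha_i}}$. *)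

theory Defs
  imports Complex_Main "HOL-Library.Countable_Set"
begin

section \<open>Countable ordinals\<close>

unbundle cardinal_syntax

text \<open>
  The well-order \<open>cardSuc natLeq\<close> has order type \<open>\<omega>\<^sub>1\<close>, so the elements of its field, ordered
  by it, are the countable ordinals.
\<close>

typedef countable_ordinal = "Field (cardSuc natLeq)"
  using cardSuc_ordLeq[OF natLeq_Card_order] Field_natLeq
  by (metis Field_empty UNIV_not_empty equals0I ordLeq_Well_order_simp
      card_of_empty3 card_of_mono2 Field_card_of)

lemma Card_order_omega1: "Card_order (cardSuc natLeq)"
  by (rule cardSuc_Card_order[OF natLeq_Card_order])

lemma Well_order_omega1: "Well_order (cardSuc natLeq)"
  using Card_order_omega1 card_order_on_def by blast

instantiation countable_ordinal :: wellorder
begin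

definition less_eq_countable_ordinal :: "countable_ordinal \<Rightarrow> countable_ordinal \<Rightarrow> bool" where
  "a \<le> b \<longleftrightarrow> (Rep_countable_ordinal a, Rep_countable_ordinal b) \<in> cardSuc natLeq"

definition less_countable_ordinal :: "countable_ordinal \<Rightarrow> countable_ordinal \<Rightarrow> bool" where
  "a < b \<longleftrightarrow> a \<le> b \<and> \<not> b \<le> (a :: countable_ordinal)"

instance
proof
  let ?r = "cardSuc natLeq"
  have wo: "Refl ?r" "trans ?r" "antisym ?r" "Total ?r" "wf (?r - Id)"
    using Well_order_omega1
    by (auto simp: well_order_on_def linear_order_on_def partial_order_on_def preorder_on_def)
  fix x y z :: countable_ordinal
  show "x < y \<longleftrightarrow> x \<le> y \<and> \<not> y \<le> x" by (rule less_countable_ordinal_def)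
  show "x \<le> x"
    using wo(1) Rep_countable_ordinal by (auto simp: less_eq_countable_ordinal_def refl_on_def)
  show "x \<le> y \<Longrightarrow> y \<le> z \<Longrightarrow> x \<le> z"
    using wo(2) unfolding less_eq_countable_ordinal_def by (blast dest: transD)
  show "x \<le> y \<Longrightarrow> y \<le> x \<Longrightarrow> x = y"
    using wo(3) unfolding less_eq_countable_ordinal_def
    by (metis antisymD Rep_countable_ordinal_inject)
  show "x \<le> y \<or> y \<le> x"
    using wo(1,4) Rep_countable_ordinal unfolding less_eq_countable_ordinal_def
    by (metis refl_onD total_on_def)
  fix P :: "countable_ordinal \<Rightarrow> bool" and a
  assume step: "\<And>x. (\<And>y. y < x \<Longrightarrow> P y) \<Longrightarrow> P x"
  have "wf (inv_image (?r - Id) Rep_countable_ordinal)"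
    by (rule wf_inv_image[OF wo(5)])
  then show "P a"
  proof (induction a rule: wf_induct_rule)
    case (less x)
    show ?case
    proof (rule step)
      fix y assume "y < x"
      then have "(y, x) \<in> inv_image (?r - Id) Rep_countable_ordinal"
        by (auto simp: less_countable_ordinal_def less_eq_countable_ordinal_def)
      then show "P y" by (rule less)
    qed
  qed
qed

end

lemma countable_initial_segment: "countable {..<a :: countable_ordinal}"
proof -
  let ?r = "cardSuc natLeq"
  have "|underS ?r (Rep_countable_ordinal a)| <o ?r"
    by (rule card_of_underS[OF Card_order_omega1 Rep_countable_ordinal])
  then have "|underS ?r (Rep_countable_ordinal a)| \<le>o natLeq"
    using cardSuc_ordLeq_ordLess[OF natLeq_Card_order card_of_Card_order] by blast
  then have "|underS ?r (Rep_countable_ordinal a)| \<le>o |UNIV :: nat set|"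
    using card_of_nat ordIso_symmetric ordLeq_ordIso_trans by blast
  then have "countable (underS ?r (Rep_countable_ordinal a))"
    unfolding countable_def card_of_ordLeq[symmetric] by blast
  moreover have "Rep_countable_ordinal ` {..<a} \<subseteq> underS ?r (Rep_countable_ordinal a)"
    by (auto simp: underS_def less_countable_ordinal_def less_eq_countable_ordinal_def)
  ultimately have "countable (Rep_countable_ordinal ` {..<a})"
    using countable_subset by blast
  then show ?thesis
    by (rule countable_image_inj_on) (simp add: inj_on_def Rep_countable_ordinal_inject)
qed

lemma uncountable_countable_ordinals: "uncountable (UNIV :: countable_ordinal set)"
proof
  let ?r = "cardSuc natLeq"
  assume "countable (UNIV :: countable_ordinal set)"
  then have "countable (range Rep_countable_ordinal)" by simp
  then have "countable (Field ?r)"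
    by (simp add: type_definition.Rep_range[OF type_definition_countable_ordinal])
  then have "|Field ?r| \<le>o |UNIV :: nat set|"
    unfolding countable_def card_of_ordLeq[symmetric] by blast
  then have "|Field ?r| \<le>o natLeq"
    using card_of_nat ordLeq_ordIso_trans by blast
  then have "?r \<le>o natLeq"
    using card_of_Field_ordIso[OF Card_order_omega1] ordIso_symmetric ordIso_ordLeq_trans by blast
  then show False
    using cardSuc_greater[OF natLeq_Card_order] not_ordLess_ordLeq by blast
qed

lemma countable_strictly_bounded:
  assumes "countable (A :: countable_ordinal set)"
  shows "\<exists>b. \<forall>a\<in>A. a < b"
proof (rule ccontr)
  assume "\<not> ?thesis"
  then have "\<forall>b. \<exists>a\<in>A. b \<le> a" by (auto simp: not_less)
  then have "UNIV = (\<Union>a\<in>A. {..a})" by auto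
  moreover have "countable {..a}" for a :: countable_ordinal
    using countable_initial_segment[of a] by (simp add: ivl_disj_un(2)[symmetric])
  ultimately show False
    using assms uncountable_countable_ordinals by (metis countable_UN)
qed

definition osuc :: "countable_ordinal \<Rightarrow> countable_ordinal" where
  "osuc a = (LEAST b. a < b)"

definition osup :: "countable_ordinal set \<Rightarrow> countable_ordinal" where
  "osup A = (LEAST b. \<forall>a\<in>A. a \<le> b)"

definition is_osuc :: "countable_ordinal \<Rightarrow> bool" where
  "is_osuc a \<longleftrightarrow> (\<exists>b. a = osuc b)"

function oplus :: "countable_ordinal \<Rightarrow> countable_ordinal \<Rightarrow> countable_ordinal" where
  "oplus a b = osup (insert a ((\<lambda>c. osuc (oplus a c)) ` {..<b}))"
  by auto
termination
  by (relation "inv_image {(x, y). x < y} snd") (auto intro: wf_inv_image wf)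

declare oplus.simps [simp del]

instantiation countable_ordinal :: "{zero, plus}"
begin

definition zero_countable_ordinal :: countable_ordinal where
  "0 = (LEAST a :: countable_ordinal. True)"

definition plus_countable_ordinal :: "countable_ordinal \<Rightarrow> countable_ordinal \<Rightarrow> countable_ordinal" where
  "a + b = oplus a b"

instance ..

end

definition is_olimit :: "countable_ordinal \<Rightarrow> bool" where
  "is_olimit a \<longleftrightarrow> a \<noteq> 0 \<and> \<not> is_osuc a"

lemma less_osuc: "a < osuc a"
  unfolding osuc_def using countable_strictly_bounded[of "{a}"] by (auto intro: LeastI_ex)

lemma less_osuc_iff [simp]: "a < osuc b \<longleftrightarrow> a \<le> b"
proof
  show "a < osuc b \<Longrightarrow> a \<le> b"
    unfolding osuc_def using not_less_Least not_less by blast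
  show "a \<le> b \<Longrightarrow> a < osuc b"
    using less_osuc le_less_trans by blast
qed

lemma osuc_le_iff [simp]: "osuc a \<le> b \<longleftrightarrow> a < b"
  using less_osuc_iff[of b a] by (simp flip: not_less)

lemma osuc_inject [simp]: "osuc a = osuc b \<longleftrightarrow> a = b"
  by (metis less_osuc_iff order_antisym order_refl)

lemma ozero_le [simp]: "(0 :: countable_ordinal) \<le> a"
  unfolding zero_countable_ordinal_def by (rule Least_le) simp

lemma not_less_ozero [simp]: "\<not> a < (0 :: countable_ordinal)"
  by (simp add: not_less)

lemma osuc_neq_ozero [simp]: "osuc a \<noteq> 0"
  by (metis less_osuc not_less_ozero)

lemma osup_le_iff:
  assumes "countable A"
  shows "osup A \<le> b \<longleftrightarrow> (\<forall>a\<in>A. a \<le> b)"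
proof
  have "\<exists>b. \<forall>a\<in>A. a \<le> b"
    using countable_strictly_bounded[OF assms] less_imp_le by blast
  then have "\<forall>a\<in>A. a \<le> osup A"
    unfolding osup_def by (rule LeastI_ex)
  then show "osup A \<le> b \<Longrightarrow> \<forall>a\<in>A. a \<le> b" by auto
  show "\<forall>a\<in>A. a \<le> b \<Longrightarrow> osup A \<le> b"
    unfolding osup_def by (rule Least_le)
qed

lemma osup_eqI:
  assumes "countable A" "\<And>a. a \<in> A \<Longrightarrow> a \<le> b" "\<And>c. (\<And>a. a \<in> A \<Longrightarrow> a \<le> c) \<Longrightarrow> b \<le> c"
  shows "osup A = b"
  using osup_le_iff[OF assms(1)] assms(2,3) by (meson order_antisym order_refl)

lemma oplus_le_iff:
  fixes a b c :: countable_ordinal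
  shows "a + b \<le> c \<longleftrightarrow> a \<le> c \<and> (\<forall>d<b. a + d < c)"
  unfolding plus_countable_ordinal_def
  by (subst oplus.simps, subst osup_le_iff) (auto simp: countable_initial_segment)

lemma oplus_zero: "a + 0 = (a :: countable_ordinal)"
  by (rule order_antisym; metis oplus_le_iff not_less_ozero order_refl)

lemma oplus_strict_mono: "b < c \<Longrightarrow> a + b < a + (c :: countable_ordinal)"
  using oplus_le_iff by blast

lemma oplus_mono: "b \<le> c \<Longrightarrow> a + b \<le> a + (c :: countable_ordinal)"
  using oplus_strict_mono by (auto simp: le_less)

lemma oplus_osuc: "a + osuc b = osuc (a + b)"
proof (rule order_antisym)
  show "a + osuc b \<le> osuc (a + b)"
    unfolding oplus_le_iff[of a "osuc b"]
    using oplus_le_iff[of a b "a + b"] by (auto intro: oplus_mono less_imp_le le_less_trans[OF _ less_osuc])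
  show "osuc (a + b) \<le> a + osuc b"
    by (simp add: oplus_strict_mono less_osuc)
qed

lemma olimit_osuc_less: "is_olimit b \<Longrightarrow> d < b \<Longrightarrow> osuc d < b"
  unfolding is_olimit_def is_osuc_def by (metis osuc_le_iff le_less)

lemma oplus_olimit:
  assumes "is_olimit b"
  shows "a + b = osup ((\<lambda>c. a + c) ` {..<b})"
proof (rule osup_eqI[symmetric])
  show "countable ((\<lambda>c. a + c) ` {..<b})" by (simp add: countable_initial_segment)
  show "c \<le> a + b" if "c \<in> (\<lambda>c. a + c) ` {..<b}" for c
    using that by (auto intro: oplus_mono)
  show "a + b \<le> c" if *: "\<And>x. x \<in> (\<lambda>c. a + c) ` {..<b} \<Longrightarrow> x \<le> c" for c
    unfolding oplus_le_iff
  proof safe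
    have "0 < b" using assms by (simp add: is_olimit_def less_le)
    then have "a + 0 \<le> c" by (intro *) blast
    then show "a \<le> c" by (simp add: oplus_zero)
    fix d assume "d < b"
    then have "a + osuc d \<le> c" using olimit_osuc_less[OF assms] by (intro *) blast
    then show "a + d < c" by (simp add: oplus_osuc)
  qed
qed

instance countable_ordinal :: monoid_add
proof
  fix a b c :: countable_ordinal
  show "a + 0 = a" by (rule oplus_zero)
  show "0 + a = a"
  proof (induction a rule: less_induct)
    case (less x)
    have "0 + x \<le> c \<longleftrightarrow> x \<le> c" for c
      unfolding oplus_le_iff by (metis less leI less_irrefl less_le_trans ozero_le)
    then show ?case by (meson order_antisym order_refl)
  qed
  show "a + b + c = a + (b + c)"
  proof (induction c rule: less_induct)
    case (less x)
    have "a + b + x \<le> c \<longleftrightarrow> a + (b + x) \<le> c" for c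
    proof
      assume *: "a + b + x \<le> c"
      show "a + (b + x) \<le> c" unfolding oplus_le_iff[of a "b + x"]
      proof safe
        show "a \<le> c" using * by (metis oplus_le_iff)
        fix d assume d: "d < b + x"
        show "a + d < c"
        proof (cases "d < b")
          case True
          then show ?thesis using * by (metis oplus_le_iff)
        next
          case False
          then obtain e where "e < x" "d \<le> b + e"
            using d oplus_le_iff[of b x d] by (meson not_le)
          then show ?thesis using * less oplus_mono
            by (metis oplus_le_iff[of "a + b" x c] le_less_trans)
        qed
      qed
    next
      assume "a + (b + x) \<le> c"
      then show "a + b + x \<le> c" unfolding oplus_le_iff[of "a + b" x]
        using less oplus_strict_mono oplus_mono
        by (metis oplus_le_iff[of b x "b + x"] less_le_trans order.trans order_refl)
    qed
    then show ?case by (meson order_antisym order_refl)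
  qed
qed

definition ocopies :: "nat \<Rightarrow> countable_ordinal \<Rightarrow> countable_ordinal" where
  "ocopies p a = sum_list (replicate p a)"

text \<open>
  The power \<open>\<omega>\<^sup>a\<close>; the usual recursion is \<open>opow_zero\<close>, \<open>opow_osuc\<close> and \<open>opow_olimit\<close> below.
\<close>

function opow :: "countable_ordinal \<Rightarrow> countable_ordinal" where
  "opow a = osup (insert (osuc 0) (\<Union>b\<in>{..<a}. range (\<lambda>p. ocopies p (opow b))))"
  by auto
termination
  by (relation "{(x, y). x < y}") (auto intro: wf)

declare opow.simps [simp del]

lemma opow_le_iff: "opow a \<le> c \<longleftrightarrow> 0 < c \<and> (\<forall>b<a. \<forall>p. ocopies p (opow b) \<le> c)"
  by (subst opow.simps, subst osup_le_iff) (auto simp: countable_initial_segment)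

lemma opow_zero: "opow 0 = osuc 0"
  by (rule order_antisym) (auto simp: opow_le_iff, metis opow_le_iff order_refl)

lemma opow_pos [simp]: "0 < opow a"
  using opow_le_iff[of a "opow a"] by simp

lemma ocopies_le_opow: "b < a \<Longrightarrow> ocopies p (opow b) \<le> opow a"
  using opow_le_iff[of a "opow a"] by simp

lemma ocopies_Suc: "ocopies (Suc p) a = ocopies p a + a"
proof -
  have "replicate (Suc p) a = replicate p a @ [a]" by (simp add: replicate_append_same)
  then show ?thesis unfolding ocopies_def by (simp del: replicate_Suc)
qed

lemma ocopies_1 [simp]: "ocopies (Suc 0) a = a"
  by (simp add: ocopies_def)

lemma ocopies_strict_mono:
  assumes "0 < a" "p < q"
  shows "ocopies p a < ocopies q a"
  using assms(2)
proof (induction rule: strict_inc_induct)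
  case (base i)
  then show ?case using oplus_strict_mono[OF assms(1), of "ocopies i a"] by (simp add: ocopies_Suc)
next
  case (step i)
  then show ?case using oplus_strict_mono[OF assms(1), of "ocopies i a"]
    by (simp add: ocopies_Suc)
qed

lemma opow_strict_mono: "a < b \<Longrightarrow> opow a < opow b"
  using ocopies_strict_mono[OF opow_pos, of "Suc 0" 2 a] ocopies_le_opow[of a b 2] by simp

lemma opow_inject [simp]: "opow a = opow b \<longleftrightarrow> a = b"
  by (metis opow_strict_mono less_irrefl neqE)

lemma opow_less_iff [simp]: "opow a < opow b \<longleftrightarrow> a < b"
  by (metis opow_strict_mono less_asym neqE less_irrefl)

lemma opow_osuc: "opow (osuc a) = osup (range (\<lambda>p. ocopies p (opow a)))"
proof (rule osup_eqI[symmetric])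
  show "c \<le> opow (osuc a)" if "c \<in> range (\<lambda>p. ocopies p (opow a))" for c
    using that by (auto intro: ocopies_le_opow)
  show "opow (osuc a) \<le> c" if *: "\<And>x. x \<in> range (\<lambda>p. ocopies p (opow a)) \<Longrightarrow> x \<le> c" for c
    unfolding opow_le_iff
  proof safe
    have "ocopies (Suc 0) (opow a) \<le> c" by (intro * rangeI)
    then have le: "opow a \<le> c" by simp
    then show "0 < c" using opow_pos less_le_trans by blast
    fix b p assume "b < osuc a"
    then consider "b < a" | "b = a" by force
    then show "ocopies p (opow b) \<le> c"
      by cases (use le ocopies_le_opow * in \<open>auto intro: order_trans\<close>)
  qed
qed simp

lemma opow_olimit:
  assumes "is_olimit a"
  shows "opow a = osup (opow ` {..<a})"
proof (rule osup_eqI[symmetric])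
  show "countable (opow ` {..<a})" by (simp add: countable_initial_segment)
  show "c \<le> opow a" if "c \<in> opow ` {..<a}" for c
    using that by (auto intro: less_imp_le)
  show "opow a \<le> c" if *: "\<And>x. x \<in> opow ` {..<a} \<Longrightarrow> x \<le> c" for c
    unfolding opow_le_iff
  proof safe
    have "0 < a" using assms by (simp add: is_olimit_def less_le)
    then show "0 < c" using *[of "opow 0"] opow_pos less_le_trans by blast
    fix b p assume "b < a"
    then have "opow (osuc b) \<le> c" using olimit_osuc_less[OF assms] by (intro *) blast
    then show "ocopies p (opow b) \<le> c"
      using ocopies_le_opow[of b "osuc b" p] by (simp add: less_osuc order_trans)
  qed
qed

lemma is_olimit_opow:
  assumes "0 < a"
  shows "is_olimit (opow a)"
  unfolding is_olimit_def is_osuc_def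
proof safe
  show "opow a = 0 \<Longrightarrow> False" using opow_pos[of a] by simp
  fix c assume c: "opow a = osuc c"
  then have "c \<noteq> 0" using opow_inject[of a 0] assms by (auto simp: opow_zero)
  then have "0 < c" by (simp add: less_le)
  moreover have "\<not> opow a \<le> c" using c by simp
  ultimately obtain b p where b: "b < a" "c < ocopies p (opow b)"
    by (auto simp: opow_le_iff not_le)
  then have "osuc c \<le> ocopies p (opow b)" by simp
  also have "\<dots> < ocopies (Suc p) (opow b)" by (rule ocopies_strict_mono) simp_all
  also have "\<dots> \<le> osuc c" using ocopies_le_opow[OF b(1)] c by metis
  finally show False by simp
qed

section \<open>The complete thin Schreier system\<close>

text \<open>
  The natural numbers of the source start at 1, hence the sets \<open>{1..}\<close> below; finite subsets of
  \<open>M\<close> are the members of \<^const>\<open>Fpow\<close> \<open>M\<close>.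
\<close>

definition fundamental_sequences :: "(countable_ordinal \<Rightarrow> nat \<Rightarrow> countable_ordinal) \<Rightarrow> bool" where
  "fundamental_sequences fs \<longleftrightarrow>
    (\<forall>l. is_olimit l \<longrightarrow>
      strict_mono_on {1..} (fs l) \<and> (\<forall>n\<ge>1. is_osuc (fs l n) \<and> fs l n < l) \<and>
      osup (fs l ` {1..}) = l)"

lemma fundamental_sequences_exist: "\<exists>fs. fundamental_sequences fs"
proof -
  have "\<exists>f :: nat \<Rightarrow> countable_ordinal. strict_mono_on {1..} f \<and> (\<forall>n\<ge>1. is_osuc (f n) \<and> f n < l) \<and> osup (f ` {1..}) = l"
    if l: "is_olimit l" for l
  proof -
    have pos: "0 < l" using l by (simp add: is_olimit_def less_le)
    define e where "e = from_nat_into {..<l}"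
    have e: "range e = {..<l}"
      unfolding e_def using pos
      by (intro range_from_nat_into countable_initial_segment) auto
    define f where "f = rec_nat (osuc 0) (\<lambda>n x. osuc (max x (e n)))"
    have f_Suc: "f (Suc n) = osuc (max (f n) (e n))" for n by (simp add: f_def)
    have less: "f n < l" for n
      by (induction n) (use e pos l in \<open>auto simp: f_def intro!: olimit_osuc_less\<close>)
    have succ: "is_osuc (f n)" for n
      by (cases n) (auto simp: f_def is_osuc_def)
    have mono: "strict_mono f"
      by (simp add: strict_mono_Suc_iff f_Suc)
    have "osup (f ` {1..}) = l"
    proof (rule osup_eqI)
      show "x \<le> l" if "x \<in> f ` {1..}" for x
        using that less by (auto intro: less_imp_le)
      show "l \<le> c" if *: "\<And>x. x \<in> f ` {1..} \<Longrightarrow> x \<le> c" for c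
      proof (rule ccontr)
        assume "\<not> l \<le> c"
        then have "c \<in> range e" using e by auto
        then obtain n where n: "c = e n" by auto
        have "f (Suc n) \<le> c" by (intro * imageI) simp
        then show False by (simp add: f_Suc n)
      qed
    qed simp
    then show ?thesis
      using mono succ less by (intro exI[of _ f]) (auto simp: strict_mono_on_def strict_mono_def)
  qed
  then show ?thesis
    unfolding fundamental_sequences_def by metis
qed

text \<open>
  For nonempty finite sets this is \<open>max s < min t\<close>; the empty set is allowed on the right
  because the successor clause below treats \<open>{n} < \<emptyset>\<close> as true.
\<close>

definition block_less :: "nat set \<Rightarrow> nat set \<Rightarrow> bool" (infix "\<lless>" 50) where
  "s \<lless> t \<longleftrightarrow> s \<noteq> {} \<and> (t = {} \<or> Max s < Min t)"

text \<open>
  \<open>schreier fs \<xi> s\<close> means \<open>s \<in> \<A>\<^sub>\<xi>\<close>. The five clauses apply to disjoint sets of indices \<open>\<xi>\<close> and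
  refer only to smaller indices, so the inductive predicate is the one given by the transfinite
  recursion. In the last clause \<open>cs\<close> lists the pairs of exponent and coefficient of the Cantor
  normal form of \<open>\<xi>\<close>, starting with \<open>(\<alpha>, p)\<close>; the entry \<open>bs ! i\<close> lists the blocks
  \<open>s\<^sup>i\<^sub>1 < \<dots> < s\<^sup>i\<^sub>p\<^sub>i\<close>, where \<open>i = 0\<close> and \<open>p\<^sub>0 = p\<close> belong to \<open>s\<^sub>0\<close>. The bound \<open>opow \<alpha> < \<xi>\<close> rules out
  the case of a single term with coefficient 1.
\<close>

inductive schreier ::
  "(countable_ordinal \<Rightarrow> nat \<Rightarrow> countable_ordinal) \<Rightarrow> countable_ordinal \<Rightarrow> nat set \<Rightarrow> bool"
  for fs where
  schreier_zero: "schreier fs 0 {}"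
| schreier_osuc:
    "\<lbrakk>schreier fs \<zeta> s; n \<ge> 1; {n} \<lless> s\<rbrakk> \<Longrightarrow> schreier fs (osuc \<zeta>) ({n} \<union> s)"
| schreier_opow_osuc:
    "\<lbrakk>ss \<noteq> []; length ss = Min (hd ss); sorted_wrt (\<lless>) ss;
      \<forall>s\<in>set ss. schreier fs (opow \<beta>) s\<rbrakk>
     \<Longrightarrow> schreier fs (opow (osuc \<beta>)) (\<Union>(set ss))"
| schreier_opow_olimit:
    "\<lbrakk>is_olimit l; s \<noteq> {}; schreier fs (opow (fs l (Min s))) s\<rbrakk> \<Longrightarrow> schreier fs (opow l) s"
| schreier_olimit:
    "\<lbrakk>is_olimit \<xi>; 0 < \<alpha>; opow \<alpha> < \<xi>; \<xi> < opow (osuc \<alpha>);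
      cs = (\<alpha>, p) # cs'; sorted_wrt (>) (map fst cs); \<forall>(\<beta>, q)\<in>set cs. 0 < \<beta> \<and> 1 \<le> q;
      \<xi> = (\<Sum>(\<beta>, q)\<leftarrow>cs. ocopies q (opow \<beta>));
      length bs = length cs;
      \<forall>i<length cs. length (bs ! i) = snd (cs ! i) \<and> sorted_wrt (\<lless>) (bs ! i) \<and>
        (\<forall>s\<in>set (bs ! i). schreier fs (opow (fst (cs ! i))) s);
      sorted_wrt (\<lambda>s t. t \<lless> s) (map (\<lambda>b. \<Union>(set b)) bs)\<rbrakk>
     \<Longrightarrow> schreier fs \<xi> (\<Union>b\<in>set bs. \<Union>(set b))"

definition Schreier_family ::
  "(countable_ordinal \<Rightarrow> nat \<Rightarrow> countable_ordinal) \<Rightarrow> countable_ordinal \<Rightarrow> nat set set" where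
  "Schreier_family fs \<xi> = {s. schreier fs \<xi> s}"

lemma not_is_osuc_opow: "0 < a \<Longrightarrow> opow a \<noteq> osuc c"
  using is_olimit_opow[of a] by (auto simp: is_olimit_def is_osuc_def)

lemma olimit_pos: "is_olimit l \<Longrightarrow> 0 < l"
  by (simp add: is_olimit_def less_le)

lemma opow_neq_ozero [simp]: "opow a \<noteq> 0"
  using opow_pos[of a] by (metis less_irrefl)

lemma osuc_pos [simp]: "0 < osuc a"
  by simp

lemma not_is_olimit_osuc: "\<not> is_olimit (osuc a)"
  by (auto simp: is_olimit_def is_osuc_def)

lemma Schreier_family_zero: "Schreier_family fs 0 = {{}}"
proof -
  have "schreier fs 0 s \<longleftrightarrow> s = {}" for s
    by (subst schreier.simps) (simp add: is_olimit_def opow_neq_ozero[symmetric] osuc_neq_ozero[symmetric]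
        del: opow_neq_ozero osuc_neq_ozero)
  then show ?thesis by (auto simp: Schreier_family_def)
qed

lemma Schreier_family_osuc:
  "Schreier_family fs (osuc \<zeta>) = {{n} \<union> s | n s. n \<ge> 1 \<and> {n} \<lless> s \<and> s \<in> Schreier_family fs \<zeta>}"
proof -
  have "schreier fs (osuc \<zeta>) s \<longleftrightarrow> (\<exists>n t. s = {n} \<union> t \<and> n \<ge> 1 \<and> {n} \<lless> t \<and> schreier fs \<zeta> t)" for s
  proof
    assume "schreier fs (osuc \<zeta>) s"
    then show "\<exists>n t. s = {n} \<union> t \<and> n \<ge> 1 \<and> {n} \<lless> t \<and> schreier fs \<zeta> t"
    proof (cases rule: schreier.cases)
      case schreier_zero
      then show ?thesis by simp
    next
      case schreier_osuc
      then show ?thesis by auto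
    next
      case (schreier_opow_osuc ss \<beta>)
      then show ?thesis using not_is_osuc_opow[OF osuc_pos] by metis
    next
      case (schreier_opow_olimit l)
      then show ?thesis using not_is_osuc_opow[OF olimit_pos] by metis
    next
      case schreier_olimit
      then have "is_olimit (osuc \<zeta>)" by blast
      then show ?thesis by (simp add: not_is_olimit_osuc)
    qed
  qed (auto intro: schreier.schreier_osuc simp del: insert_is_Un Un_insert_left)
  then show ?thesis by (auto simp: Schreier_family_def)
qed

lemma Schreier_family_opow_osuc:
  "Schreier_family fs (opow (osuc \<beta>)) =
    {\<Union>(set ss) | ss. ss \<noteq> [] \<and> length ss = Min (hd ss) \<and> sorted_wrt (\<lless>) ss \<and>
      set ss \<subseteq> Schreier_family fs (opow \<beta>)}"
proof -
  have "schreier fs (opow (osuc \<beta>)) s \<longleftrightarrow>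
    (\<exists>ss. s = \<Union>(set ss) \<and> ss \<noteq> [] \<and> length ss = Min (hd ss) \<and> sorted_wrt (\<lless>) ss \<and>
      (\<forall>s\<in>set ss. schreier fs (opow \<beta>) s))" (is "_ \<longleftrightarrow> ?R") for s
  proof
    assume "schreier fs (opow (osuc \<beta>)) s"
    then show ?R
    proof (cases rule: schreier.cases)
      case schreier_zero
      then show ?thesis by simp
    next
      case schreier_osuc
      then show ?thesis using not_is_osuc_opow[OF osuc_pos] by metis
    next
      case (schreier_opow_osuc ss \<beta>')
      then show ?thesis by auto
    next
      case (schreier_opow_olimit l)
      then show ?thesis by (auto simp: is_olimit_def is_osuc_def)
    next
      case (schreier_olimit \<alpha>)
      then have "opow \<alpha> < opow (osuc \<beta>)" "opow (osuc \<beta>) < opow (osuc \<alpha>)" by blast+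
      then show ?thesis by (metis leD less_osuc_iff opow_less_iff osuc_le_iff)
    qed
  qed (auto intro: schreier.schreier_opow_osuc)
  then show ?thesis by (auto simp: Schreier_family_def)
qed

lemma Schreier_family_opow_olimit:
  assumes "is_olimit l"
  shows "Schreier_family fs (opow l) =
    {s. s \<noteq> {} \<and> s \<in> Schreier_family fs (opow (fs l (Min s)))}"
proof -
  have "schreier fs (opow l) s \<longleftrightarrow> s \<noteq> {} \<and> schreier fs (opow (fs l (Min s))) s" (is "_ \<longleftrightarrow> ?R") for s
  proof
    assume "schreier fs (opow l) s"
    then show ?R
    proof (cases rule: schreier.cases)
      case schreier_zero
      then show ?thesis by simp
    next
      case schreier_osuc
      then show ?thesis using not_is_osuc_opow[OF olimit_pos[OF assms]] by metis
    next
      case (schreier_opow_osuc ss \<beta>')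
      then show ?thesis using assms by (auto simp: is_olimit_def is_osuc_def)
    next
      case (schreier_opow_olimit l)
      then show ?thesis by auto
    next
      case (schreier_olimit \<alpha>)
      then have "opow \<alpha> < opow l" "opow l < opow (osuc \<alpha>)" by blast+
      then show ?thesis by (metis leD less_osuc_iff opow_less_iff)
    qed
  qed (auto intro: schreier.schreier_opow_olimit[OF assms])
  then show ?thesis by (auto simp: Schreier_family_def)
qed

lemma schreier_subset: "schreier fs \<xi> s \<Longrightarrow> finite s \<and> s \<subseteq> {1..}"
proof (induction rule: schreier.induct)
  case (schreier_olimit \<xi> \<alpha> cs p cs' bs)
  then have "\<forall>b\<in>set bs. \<forall>s\<in>set b. finite s \<and> s \<subseteq> {1..}"
    by (metis in_set_conv_nth)
  then show ?case by (auto; blast)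
qed (auto; fastforce)+

end

(*
  By induction on \<xi> the family A_\<xi> is thin: no member is a proper initial segment of another.
  The successor and limit steps hold because two comparable increasing unions of equally many
  blocks from thin families agree block by block; at a limit that is not a power of \<omega>, the
  shape of the union is determined by \<xi> since Cantor normal forms are unique.

  For thin families the dichotomy is the theorem of Nash-Williams. It follows from Galvin's lemma:
  for every family G of finite sets there is an infinite L \<subseteq> M such that L contains no member of G,
  or every infinite subset of L has an initial segment in G. Taking for G the intersection of
  A_\<xi> and F, in the second case every member of A_\<xi> contained in L extends to an infinite
  subset of L, hence is comparable with, and by thinness equal to, a member of F.
*)

theory Submission
  imports Defs
begin

section \<open>Initial segments\<close>

text \<open>An initial segment is a cut at a bound, so \<open>s\<close> is finite while
  \<open>t\<close> may be infinite, as Galvin's lemma requires.\<close>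

definition init_seg :: "nat set \<Rightarrow> nat set \<Rightarrow> bool" where
  "init_seg s t \<longleftrightarrow> (\<exists>n. s = t \<inter> {..<n})"

definition comparable :: "nat set \<Rightarrow> nat set \<Rightarrow> bool" where
  "comparable s t \<longleftrightarrow> init_seg s t \<or> init_seg t s"

definition thin :: "nat set set \<Rightarrow> bool" where
  "thin T \<longleftrightarrow> (\<forall>s\<in>T. \<forall>t\<in>T. comparable s t \<longrightarrow> s = t)"

lemma init_seg_trans: "init_seg s t \<Longrightarrow> init_seg t u \<Longrightarrow> init_seg s u"
  unfolding init_seg_def
proof safe
  fix n m
  show "\<exists>k. u \<inter> {..<n} \<inter> {..<m} = u \<inter> {..<k}"
    by (rule exI[of _ "min n m"]) auto
qed

lemma init_seg_comparable:
  assumes "init_seg s u" "init_seg t u"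
  shows "comparable s t"
proof -
  obtain n m where nm: "s = u \<inter> {..<n}" "t = u \<inter> {..<m}"
    using assms unfolding init_seg_def by blast
  show ?thesis
  proof (cases "n \<le> m")
    case True
    then have "s = t \<inter> {..<n}" using nm by auto
    then show ?thesis by (auto simp: comparable_def init_seg_def)
  next
    case False
    then have "t = s \<inter> {..<m}" using nm by auto
    then show ?thesis by (auto simp: comparable_def init_seg_def)
  qed
qed

lemma init_seg_Un:
  assumes "finite x" "\<And>a b. a \<in> x \<Longrightarrow> b \<in> X \<Longrightarrow> a < b"
  shows "init_seg x (x \<union> X)"
proof (cases "x = {}")
  case True
  then show ?thesis unfolding init_seg_def by (intro exI[of _ 0]) auto
next
  case False
  then have "x = (x \<union> X) \<inter> {..<Suc (Max x)}"
    using assms Max_in[OF assms(1) False] by (fastforce simp: less_Suc_eq_le)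
  then show ?thesis unfolding init_seg_def by blast
qed

section \<open>Unions of successive blocks\<close>

lemma block_less_less:
  "x \<lless> X \<Longrightarrow> finite x \<Longrightarrow> finite X \<Longrightarrow> a \<in> x \<Longrightarrow> b \<in> X \<Longrightarrow> a < b"
  unfolding block_less_def
  by (metis Max_ge Min_le empty_iff le_less_trans less_le_trans)

lemma block_less_Union_less:
  assumes "\<forall>X\<in>set xs. x \<lless> X" "finite x" "\<forall>X\<in>set xs. finite X" "a \<in> x" "b \<in> \<Union>(set xs)"
  shows "a < b"
  using assms block_less_less by (metis UnionE)

text \<open>A nonempty initial segment contains the least element. This recovers, from a set alone,
  the number that governs the two clauses for powers of \<omega>.\<close>

lemma Min_comparable:
  assumes "finite s" "finite t" "s \<noteq> {}" "t \<noteq> {}" "comparable s t"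
  shows "Min s = Min t"
proof -
  have *: "Min s = Min t" if t: "finite t" "s \<noteq> {}" "init_seg s t" for s t
  proof -
    obtain n where n: "s = t \<inter> {..<n}" using t(3) unfolding init_seg_def by blast
    then have fin: "finite s" using t by auto
    then have "Min s \<in> s" using t by simp
    have "Min s \<le> y" if "y \<in> t" for y
    proof (cases "y < n")
      case True
      then show ?thesis using n fin that by (intro Min_le) auto
    next
      case False
      then show ?thesis using n \<open>Min s \<in> s\<close> by auto
    qed
    then show ?thesis using \<open>Min s \<in> s\<close> n t(1) by (intro Min_eqI[symmetric]) auto
  qed
  show ?thesis using *[of t s] *[of s t] assms unfolding comparable_def by auto
qed

text \<open>Peels off the first block: \<open>x\<close> and \<open>y\<close> are both initial
  segments of the longer union, hence comparable. Once they are equal, deleting them from a cut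
  leaves a cut.\<close>

lemma comparable_UnD:
  assumes cmp: "comparable (x \<union> X) (y \<union> Y)"
    and fin: "finite x" "finite y"
    and less: "\<And>a b. a \<in> x \<Longrightarrow> b \<in> X \<Longrightarrow> a < b" "\<And>a b. a \<in> y \<Longrightarrow> b \<in> Y \<Longrightarrow> a < b"
  shows "comparable x y" and "x = y \<Longrightarrow> comparable X Y"
proof -
  have init: "init_seg x (x \<union> X)" "init_seg y (y \<union> Y)"
    using init_seg_Un fin less by blast+
  show "comparable x y"
    using cmp unfolding comparable_def[of "x \<union> X"]
  proof
    assume "init_seg (x \<union> X) (y \<union> Y)"
    from init_seg_comparable[OF init_seg_trans[OF init(1) this] init(2)] show ?thesis .
  next
    assume "init_seg (y \<union> Y) (x \<union> X)"
    from init_seg_comparable[OF init(1) init_seg_trans[OF init(2) this]] show ?thesis .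
  qed
  assume "x = y"
  have *: "init_seg X Y"
    if XY: "init_seg (x \<union> X) (x \<union> Y)" "x \<inter> X = {}" "x \<inter> Y = {}" for X Y
  proof -
    obtain n where "x \<union> X = (x \<union> Y) \<inter> {..<n}" using XY(1) unfolding init_seg_def by blast
    then have "X = Y \<inter> {..<n}" using XY(2,3) by blast
    then show ?thesis unfolding init_seg_def by blast
  qed
  have "x \<inter> X = {}" "x \<inter> Y = {}" using less \<open>x = y\<close> by fast+
  then show "comparable X Y" using * cmp \<open>x = y\<close> unfolding comparable_def by metis
qed

text \<open>Blocks are peeled off from the left. Thinness is assumed only position by position, so
  different positions may belong to different families.\<close>

lemma comparable_Union_blocks:
  assumes "list_all2 (\<lambda>s t. comparable s t \<longrightarrow> s = t) xs ys"
    and "sorted_wrt (\<lless>) xs" "sorted_wrt (\<lless>) ys"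
    and "\<forall>s\<in>set xs \<union> set ys. finite s"
    and "comparable (\<Union>(set xs)) (\<Union>(set ys))"
  shows "xs = ys"
  using assms
proof (induction rule: list_all2_induct)
  case Nil
  then show ?case by simp
next
  case (Cons x xs y ys)
  have less: "a < b" if "a \<in> x" "b \<in> \<Union>(set xs)" for a b
    using block_less_Union_less[OF _ _ _ that] Cons.prems by simp
  have less': "a < b" if "a \<in> y" "b \<in> \<Union>(set ys)" for a b
    using block_less_Union_less[OF _ _ _ that] Cons.prems by simp
  have cmp: "comparable (x \<union> \<Union>(set xs)) (y \<union> \<Union>(set ys))" and "finite x" "finite y"
    using Cons.prems by simp_all
  note D = comparable_UnD[OF this less less']
  then have "x = y" using Cons.hyps by blast
  then show ?case using D(2) Cons by simp
qed

section \<open>Uniqueness of Cantor normal forms\<close>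

text \<open>By induction the tail is below one further copy of the leading power, and finitely many
  copies of a smaller power do not exceed a larger one.\<close>

lemma cnf_less_opow:
  assumes "sorted_wrt (>) (map fst cs)" "\<forall>(\<beta>, q)\<in>set cs. \<beta> < \<alpha>"
  shows "(\<Sum>(\<beta>, q)\<leftarrow>cs. ocopies q (opow \<beta>)) < opow \<alpha>"
  using assms
proof (induction cs arbitrary: \<alpha>)
  case Nil
  then show ?case by simp
next
  case (Cons c cs)
  obtain \<beta> q where c: "c = (\<beta>, q)" by fastforce
  have "(\<Sum>(\<beta>, q)\<leftarrow>cs. ocopies q (opow \<beta>)) < opow \<beta>"
    using Cons.prems c by (intro Cons.IH) auto
  then have "(\<Sum>(\<beta>, q)\<leftarrow>c # cs. ocopies q (opow \<beta>)) < ocopies (Suc q) (opow \<beta>)"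
    using oplus_strict_mono by (simp add: c ocopies_Suc)
  also have "\<dots> \<le> opow \<alpha>" using Cons.prems c by (intro ocopies_le_opow) auto
  finally show ?case .
qed

lemma ocopies_mono: "0 < a \<Longrightarrow> p \<le> q \<Longrightarrow> ocopies p a \<le> ocopies q a"
  using ocopies_strict_mono[of a p q] by (cases "p = q") auto

lemma oplus_ge_left: "a \<le> a + (b :: countable_ordinal)"
  using oplus_le_iff[of a b "a + b"] by simp

lemma cnf_unique:
  assumes "sorted_wrt (>) (map fst cs)" "sorted_wrt (>) (map fst ds)"
    and "\<forall>(\<beta>, q)\<in>set cs. 1 \<le> q" "\<forall>(\<beta>, q)\<in>set ds. 1 \<le> q"
    and "(\<Sum>(\<beta>, q)\<leftarrow>cs. ocopies q (opow \<beta>)) = (\<Sum>(\<beta>, q)\<leftarrow>ds. ocopies q (opow \<beta>))"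
  shows "cs = ds"
  using assms
proof (induction cs arbitrary: ds)
  have ge: "opow \<beta> \<le> (\<Sum>(\<beta>, q)\<leftarrow>(\<beta>, q) # es. ocopies q (opow \<beta>))" if "1 \<le> q" for \<beta> q es
  proof -
    have "opow \<beta> \<le> ocopies q (opow \<beta>)" using ocopies_mono[of "opow \<beta>" 1 q] that by simp
    then show ?thesis using oplus_ge_left order_trans by fastforce
  qed
  {
    case Nil
    show ?case
    proof (cases ds)
      case (Cons d ds')
      obtain \<beta> q where "d = (\<beta>, q)" by fastforce
      then have "opow \<beta> \<le> 0" using ge[of q \<beta> ds'] Nil.prems Cons by simp
      then show ?thesis using opow_pos[of \<beta>] by (simp add: not_less[symmetric])
    qed simp
  next
    case (Cons c cs)
    obtain \<beta> q where c: "c = (\<beta>, q)" by fastforce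
    have "ds \<noteq> []"
    proof
      assume "ds = []"
      then have "opow \<beta> \<le> 0" using ge[of q \<beta> cs] Cons.prems c by simp
      then show False using opow_pos[of \<beta>] by (simp add: not_less[symmetric])
    qed
    then obtain \<gamma> r ds' where ds: "ds = (\<gamma>, r) # ds'" by (metis list.exhaust surj_pair)
    let ?v = "\<lambda>es. (\<Sum>(\<beta>, q)\<leftarrow>es. ocopies q (opow \<beta>))"
    have eq: "ocopies q (opow \<beta>) + ?v cs = ocopies r (opow \<gamma>) + ?v ds'"
      using Cons.prems c ds by simp
    \<comment> \<open>If the leading exponents differed, the larger leading power alone would exceed
      the other sum.\<close>
    have "\<not> \<beta> < \<gamma>"
    proof
      assume "\<beta> < \<gamma>"
      then have "?v (c # cs) < opow \<gamma>" using Cons.prems c by (intro cnf_less_opow) auto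
      also have "\<dots> \<le> ?v ds" using ge[of r \<gamma> ds'] Cons.prems ds by simp
      finally show False using Cons.prems by simp
    qed
    moreover have "\<not> \<gamma> < \<beta>"
    proof
      assume "\<gamma> < \<beta>"
      then have "?v ds < opow \<beta>" using Cons.prems ds by (intro cnf_less_opow) auto
      also have "\<dots> \<le> ?v (c # cs)" using ge[of q \<beta> cs] Cons.prems c by simp
      finally show False using Cons.prems by simp
    qed
    ultimately have [simp]: "\<gamma> = \<beta>" by simp
    \<comment> \<open>A smaller leading coefficient gives a smaller sum, since the remainder is less
      than one copy of the power.\<close>
    have lt: "ocopies q (opow \<beta>) + v < ocopies r (opow \<beta>) + w"
      if "q < r" "v < opow \<beta>" for q r v w
    proof -
      have "ocopies q (opow \<beta>) + v < ocopies (Suc q) (opow \<beta>)"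
        using that by (simp add: ocopies_Suc oplus_strict_mono)
      also have "\<dots> \<le> ocopies r (opow \<beta>)" using that by (intro ocopies_mono) auto
      also have "\<dots> \<le> ocopies r (opow \<beta>) + w" by (rule oplus_ge_left)
      finally show ?thesis .
    qed
    have "?v cs < opow \<beta>" "?v ds' < opow \<beta>"
      using Cons.prems c ds by (auto intro!: cnf_less_opow)
    then have [simp]: "r = q" using lt[of q r] lt[of r q] eq by (metis \<open>\<gamma> = \<beta>\<close> less_irrefl neqE)
    \<comment> \<open>Left cancellation, from strict monotonicity of addition in its right
      argument.\<close>
    have "?v cs = ?v ds'" using eq oplus_strict_mono by (metis \<open>\<gamma> = \<beta>\<close> \<open>r = q\<close> less_irrefl neqE)
    then have "cs = ds'" using Cons.prems c ds by (intro Cons.IH) auto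
    then show ?case using c ds by simp
  }
qed

section \<open>Thinness of the Schreier families\<close>

text \<open>Makes the minima of blocks meaningful: all blocks come from families indexed by powers
  of \<omega>, which are positive.\<close>

lemma schreier_nonempty: "schreier fs \<xi> s \<Longrightarrow> 0 < \<xi> \<Longrightarrow> s \<noteq> {}"
proof (induction rule: schreier.induct)
  case (schreier_opow_osuc ss \<beta>)
  then show ?case by (cases ss) auto
next
  case (schreier_olimit \<xi> \<alpha> cs p cs' bs)
  then have "length (bs ! 0) = p" "1 \<le> p" "0 < length bs" "0 < length cs" by auto
  moreover from this have "bs ! 0 \<noteq> []" by force
  ultimately have mem: "bs ! 0 \<in> set bs" "hd (bs ! 0) \<in> set (bs ! 0)" by simp_all
  have "hd (bs ! 0) \<noteq> {}"
    using schreier_olimit.IH \<open>0 < length cs\<close> mem(2) opow_pos by metis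
  then show ?case using mem by blast
qed auto

lemma schreier_finite: "schreier fs \<xi> s \<Longrightarrow> finite s"
  using schreier_subset by blast

text \<open>Lying strictly between consecutive powers, \<open>\<xi>\<close> is not itself a power of
  \<omega>, which excludes both power clauses.\<close>

lemma schreier_olimitE:
  assumes "schreier fs \<xi> t" "is_olimit \<xi>" "opow \<alpha> < \<xi>" "\<xi> < opow (osuc \<alpha>)"
  obtains cs bs where "t = (\<Union>b\<in>set bs. \<Union>(set b))"
    "sorted_wrt (>) (map fst cs)" "\<forall>(\<beta>, q)\<in>set cs. 1 \<le> q"
    "\<xi> = (\<Sum>(\<beta>, q)\<leftarrow>cs. ocopies q (opow \<beta>))" "length bs = length cs"
    "\<forall>i<length cs. length (bs ! i) = snd (cs ! i) \<and> sorted_wrt (\<lless>) (bs ! i) \<and>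
        (\<forall>s\<in>set (bs ! i). schreier fs (opow (fst (cs ! i))) s)"
    "sorted_wrt (\<lambda>s t. t \<lless> s) (map (\<lambda>b. \<Union>(set b)) bs)"
proof -
  have not_opow: "\<xi> \<noteq> opow \<gamma>" for \<gamma>
    using assms(3,4) by (metis leD less_osuc_iff opow_less_iff)
  show thesis
    using assms(1)
  proof (cases rule: schreier.cases)
    case schreier_zero
    then show ?thesis using assms(2) by (simp add: is_olimit_def)
  next
    case schreier_osuc
    then show ?thesis using assms(2) by (simp add: not_is_olimit_osuc)
  next
    case (schreier_olimit \<alpha>' cs p cs' bs)
    then show ?thesis by (intro that[of bs cs]) fast+
  qed (use not_opow in auto)
qed

text \<open>Induction on the derivation for \<open>s\<close>; in each case the derivation for
  \<open>t\<close> is inverted by the clause belonging to the same index.\<close>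

lemma schreier_eq_of_comparable:
  "schreier fs \<xi> s \<Longrightarrow> schreier fs \<xi> t \<Longrightarrow> comparable s t \<Longrightarrow> s = t"
proof (induction arbitrary: t rule: schreier.induct)
  case schreier_zero
  then show ?case using Schreier_family_zero by (auto simp: Schreier_family_def)
next
  case (schreier_osuc \<zeta> s n)
  from schreier_osuc.prems(1) obtain m u where
    t: "t = {m} \<union> u" "{m} \<lless> u" "schreier fs \<zeta> u"
    using Schreier_family_osuc[of fs \<zeta>] unfolding Schreier_family_def by blast
  have less: "a < b" if "a \<in> {n}" "b \<in> s" for a b
    using that schreier_osuc.hyps by (metis block_less_less finite.simps schreier_finite)
  have less': "a < b" if "a \<in> {m}" "b \<in> u" for a b
    using that t by (metis block_less_less finite.simps schreier_finite)
  have cmp: "comparable ({n} \<union> s) ({m} \<union> u)" using schreier_osuc.prems t(1) by simp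
  note D = comparable_UnD[OF cmp _ _ less less']
  \<comment> \<open>The adjoined points are the minima of the two comparable sets, so they coincide
    and can be peeled off.\<close>
  have "Min ({n} \<union> s) = n"
    using less schreier_finite[OF schreier_osuc.hyps(1)] by (intro Min_eqI) (auto intro: less_imp_le)
  moreover have "Min ({m} \<union> u) = m"
    using less' schreier_finite[OF t(3)] by (intro Min_eqI) (auto intro: less_imp_le)
  ultimately have "n = m"
    using Min_comparable[OF _ _ _ _ cmp] schreier_finite[OF t(3)]
      schreier_finite[OF schreier_osuc.hyps(1)] by auto
  then show ?case using D(2) schreier_osuc.IH t by blast
next
  case (schreier_opow_osuc ss \<beta>)
  from schreier_opow_osuc.prems(1) have "t \<in> Schreier_family fs (opow (osuc \<beta>))"
    by (simp add: Schreier_family_def)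
  then obtain ts where
    t: "t = \<Union>(set ts)" "ts \<noteq> []" "length ts = Min (hd ts)" "sorted_wrt (\<lless>) ts"
      "\<forall>s\<in>set ts. schreier fs (opow \<beta>) s"
    unfolding Schreier_family_opow_osuc by (auto simp: Schreier_family_def)
  have ne: "\<Union>(set us) \<noteq> {} \<and> finite (\<Union>(set us))"
    if us: "us \<noteq> []" "\<forall>s\<in>set us. schreier fs (opow \<beta>) s" for us
  proof
    show "\<Union>(set us) \<noteq> {}"
      using us schreier_nonempty[OF _ opow_pos] by (cases us) auto
    show "finite (\<Union>(set us))"
      using us by (intro finite_Union) (auto intro: schreier_finite)
  qed
  \<comment> \<open>The number of blocks is the minimum of the first block; this expresses it
    through the union alone, so comparable unions have equally many blocks.\<close>
  have Min_hd: "Min (\<Union>(set us)) = Min (hd us)"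
    if us: "us \<noteq> []" "sorted_wrt (\<lless>) us" "\<forall>s\<in>set us. schreier fs (opow \<beta>) s" for us
  proof (rule Min_comparable)
    obtain u us' where u: "us = u # us'" using us(1) by (cases us) auto
    have "init_seg u (u \<union> \<Union>(set us'))"
      using us u schreier_finite by (intro init_seg_Un block_less_Union_less[of us' u]) auto
    then show "comparable (\<Union>(set us)) (hd us)" by (simp add: comparable_def u)
    show "hd us \<noteq> {}" "\<Union>(set us) \<noteq> {}" "finite (hd us)" "finite (\<Union>(set us))"
      using ne[OF us(1,3)] us(3) u schreier_nonempty[OF _ opow_pos] by (auto intro: schreier_finite)
  qed
  have ss: "\<forall>s\<in>set ss. schreier fs (opow \<beta>) s" using schreier_opow_osuc by blast
  have "Min (\<Union>(set ss)) = Min t"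
    using schreier_opow_osuc.prems(2) ne[OF t(2,5)] ne[OF schreier_opow_osuc.hyps(1) ss]
    by (intro Min_comparable) (auto simp: t(1))
  then have "length ss = length ts"
    using Min_hd[OF t(2,4,5)] Min_hd[OF schreier_opow_osuc.hyps(1,3) ss]
      t(1,3) schreier_opow_osuc.hyps(2) by simp
  then have "list_all2 (\<lambda>s t. comparable s t \<longrightarrow> s = t) ss ts"
    using schreier_opow_osuc.IH t(5) by (auto simp: list_all2_conv_all_nth)
  then have "ss = ts"
    using schreier_opow_osuc.hyps(3) t ss schreier_opow_osuc.prems(2) schreier_finite
    by (intro comparable_Union_blocks) auto
  then show ?case using t by simp
next
  case (schreier_opow_olimit l s)
  have t: "t \<noteq> {}" "schreier fs (opow (fs l (Min t))) t"
    using schreier_opow_olimit.prems(1) Schreier_family_opow_olimit[OF schreier_opow_olimit.hyps(1), of fs]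
    by (auto simp: Schreier_family_def)
  \<comment> \<open>Equal minima select the same term of the fundamental sequence, so the induction
    hypothesis applies to \<open>t\<close>.\<close>
  then have "Min s = Min t"
    using schreier_opow_olimit Min_comparable schreier_finite by meson
  then show ?case using t schreier_opow_olimit by metis
next
  case (schreier_olimit \<xi> \<alpha> cs p cs' bs)
  obtain ds es where t: "t = (\<Union>b\<in>set es. \<Union>(set b))"
    "sorted_wrt (>) (map fst ds)" "\<forall>(\<beta>, q)\<in>set ds. 1 \<le> q"
    "\<xi> = (\<Sum>(\<beta>, q)\<leftarrow>ds. ocopies q (opow \<beta>))" "length es = length ds"
    "\<forall>i<length ds. length (es ! i) = snd (ds ! i) \<and> sorted_wrt (\<lless>) (es ! i) \<and>
        (\<forall>s\<in>set (es ! i). schreier fs (opow (fst (ds ! i))) s)"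
    "sorted_wrt (\<lambda>s t. t \<lless> s) (map (\<lambda>b. \<Union>(set b)) es)"
    using schreier_olimit.prems(1) schreier_olimit.hyps(1,3,4) by (rule schreier_olimitE)
  \<comment> \<open>Both decompositions now have the same block counts and draw corresponding blocks
    from the same families.\<close>
  have "cs = ds"
    using schreier_olimit.hyps t by (intro cnf_unique) auto
  note t = t[folded this]
  let ?U = "\<lambda>b :: nat set list. \<Union>(set b)"
  have blocks: "length (bs ! i) = length (es ! i)" "sorted_wrt (\<lless>) (bs ! i)" "sorted_wrt (\<lless>) (es ! i)"
    "\<And>s. s \<in> set (bs ! i) \<Longrightarrow> finite s" "\<And>s. s \<in> set (es ! i) \<Longrightarrow> finite s"
    "\<And>s t. s \<in> set (bs ! i) \<Longrightarrow> t \<in> set (es ! i) \<Longrightarrow> comparable s t \<Longrightarrow> s = t"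
    if i: "i < length cs" for i
  proof -
    note B = schreier_olimit.IH[rule_format, OF i]
    note E = t(6)[rule_format, OF i]
    show "length (bs ! i) = length (es ! i)" "sorted_wrt (\<lless>) (bs ! i)" "sorted_wrt (\<lless>) (es ! i)"
      using B E by simp_all
    show "finite s" if "s \<in> set (bs ! i)" for s using B that schreier_finite by fast
    show "finite s" if "s \<in> set (es ! i)" for s using E that schreier_finite by fast
    show "s = u" if "s \<in> set (bs ! i)" "u \<in> set (es ! i)" "comparable s u" for s u
      using B E that by fast
  qed
  have fin: "finite (?U (bs ! i))" "finite (?U (es ! i))" if "i < length cs" for i
    using blocks[OF that] by (auto intro!: finite_Union)
  have eq: "?U (bs ! i) = ?U (es ! i)"
    if i: "i < length cs" and cmp: "comparable (?U (bs ! i)) (?U (es ! i))" for i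
  proof -
    have "bs ! i = es ! i"
    proof (rule comparable_Union_blocks[OF _ _ _ _ cmp])
      show "list_all2 (\<lambda>s t. comparable s t \<longrightarrow> s = t) (bs ! i) (es ! i)"
        using blocks[OF i] by (simp add: list_all2_conv_all_nth)
      show "sorted_wrt (\<lless>) (bs ! i)" "sorted_wrt (\<lless>) (es ! i)"
        "\<forall>s\<in>set (bs ! i) \<union> set (es ! i). finite s"
        using blocks[OF i] by auto
    qed
    then show ?thesis by simp
  qed
  \<comment> \<open>The entries are listed from the rightmost part to the leftmost; reversing gives
    the increasing order in which blocks are peeled off. Here each entry's union counts as one
    block.\<close>
  have "rev (map ?U bs) = rev (map ?U es)"
  proof (rule comparable_Union_blocks)
    show "list_all2 (\<lambda>s t. comparable s t \<longrightarrow> s = t) (rev (map ?U bs)) (rev (map ?U es))"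
      unfolding list_all2_rev
      using eq schreier_olimit.hyps t(5) by (auto simp: list_all2_conv_all_nth)
    show "sorted_wrt (\<lless>) (rev (map ?U bs))" "sorted_wrt (\<lless>) (rev (map ?U es))"
      using schreier_olimit.hyps t(7) by (simp_all add: sorted_wrt_rev)
    show "\<forall>s\<in>set (rev (map ?U bs)) \<union> set (rev (map ?U es)). finite s"
      using fin schreier_olimit.hyps t(5) by (auto simp: in_set_conv_nth)
    show "comparable (\<Union>(set (rev (map ?U bs)))) (\<Union>(set (rev (map ?U es))))"
      using schreier_olimit.prems(2) t(1) by simp
  qed
  then have "map ?U bs = map ?U es" by simp
  then have "?U ` set bs = ?U ` set es" by (metis set_map)
  then show ?case using t(1) by simp
qed

lemma thin_Schreier_family: "thin (Schreier_family fs \<xi>)"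
  using schreier_eq_of_comparable by (auto simp: thin_def Schreier_family_def)

section \<open>Galvin's lemma and the Nash-Williams theorem\<close>

text \<open>A fusion argument: a hereditary, dense property that depends only on the points above
  \<open>s\<close> can be achieved for all finite subsets of one infinite set
  simultaneously.\<close>

lemma infinite_subset_all_finite_subsets:
  fixes P :: "nat set \<Rightarrow> nat set \<Rightarrow> bool" and A :: "nat set"
  assumes mono: "\<And>s A B. P s A \<Longrightarrow> B \<subseteq> A \<Longrightarrow> P s B"
    and tail: "\<And>s A. P s {n\<in>A. \<forall>x\<in>s. x < n} \<Longrightarrow> P s A"
    and dense: "\<And>s B. finite s \<Longrightarrow> B \<subseteq> A \<Longrightarrow> infinite B \<Longrightarrow> \<exists>C\<subseteq>B. infinite C \<and> P s C"
    and "infinite A"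
  shows "\<exists>B\<subseteq>A. infinite B \<and> (\<forall>s\<subseteq>B. finite s \<longrightarrow> P s B)"
proof -
  have dense_fin: "\<exists>C\<subseteq>B. infinite C \<and> (\<forall>s\<in>S. P s C)"
    if "finite S" "\<forall>s\<in>S. finite s" "B \<subseteq> A" "infinite B" for S B
    using that
  proof (induction S rule: finite_induct)
    case empty
    then show ?case by auto
  next
    case (insert s S)
    then obtain C where C: "C \<subseteq> B" "infinite C" "\<forall>s\<in>S. P s C" by auto
    obtain D where "D \<subseteq> C" "infinite D" "P s D"
      using dense[of s C] insert.prems C by auto
    then show ?case using C mono by (intro exI[of _ D]) blast
  qed
  \<comment> \<open>\<open>N\<close> holds the points chosen so far and \<open>C\<close> is the
    reservoir above them for later choices; \<open>P\<close> is already secured for every subset of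
    \<open>N\<close>.\<close>
  define I :: "nat set \<times> nat set \<Rightarrow> bool" where
    "I = (\<lambda>(N, C). finite N \<and> N \<subseteq> A \<and> C \<subseteq> A \<and> infinite C \<and> (\<forall>x\<in>N. \<forall>y\<in>C. x < y) \<and>
      (\<forall>s\<subseteq>N. P s C))"
  define R :: "nat set \<times> nat set \<Rightarrow> nat set \<times> nat set \<Rightarrow> bool" where
    "R = (\<lambda>(N, C) (N', C'). \<exists>n\<in>C. N' = insert n N \<and> C' \<subseteq> C)"
  have "\<exists>f. \<forall>k. (I (f k) \<and> (k = 0 \<longrightarrow> fst (f k) = {})) \<and> R (f k) (f (Suc k))"
  proof (rule dependent_nat_choice[where Q = "\<lambda>_. R"])
    obtain C where "C \<subseteq> A" "infinite C" "P {} C" using dense[of "{}" A] assms(4) by auto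
    then show "\<exists>x. I x \<and> (0 = (0::nat) \<longrightarrow> fst x = {})"
      by (intro exI[of _ "({}, C)"]) (auto simp: I_def)
  next
    fix x k assume "I x \<and> (k = (0::nat) \<longrightarrow> fst x = {})"
    then obtain N C where x: "x = (N, C)" and I: "finite N" "N \<subseteq> A" "C \<subseteq> A" "infinite C"
      "\<forall>x\<in>N. \<forall>y\<in>C. x < y"
      by (auto simp: I_def split: prod.splits)
    from \<open>infinite C\<close> obtain n where n: "n \<in> C" by fastforce
    \<comment> \<open>Discarding the points up to \<open>n\<close> keeps the reservoir above all
      chosen points; only finitely many subsets of \<open>insert n N\<close> need treatment.\<close>
    have "C - {..n} \<subseteq> A" "infinite (C - {..n})" using I by auto
    moreover have "finite (Pow (insert n N))" "\<forall>s\<in>Pow (insert n N). finite s"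
      using I(1) by (auto intro: finite_subset)
    ultimately obtain D where D: "D \<subseteq> C - {..n}" "infinite D" "\<forall>s\<in>Pow (insert n N). P s D"
      using dense_fin by meson
    have "I (insert n N, D)" "R x (insert n N, D)"
      using I D n by (auto simp: I_def R_def x)
    then show "\<exists>y. (I y \<and> (Suc k = 0 \<longrightarrow> fst y = {})) \<and> R x y" by auto
  qed
  then obtain f where f: "\<And>k. I (f k)" "fst (f 0) = {}" "\<And>k. R (f k) (f (Suc k))" by auto
  define N where "N k = fst (f k)" for k
  define C where "C k = snd (f k)" for k
  have I: "finite (N k)" "N k \<subseteq> A" "C k \<subseteq> A" "\<And>x y. x \<in> N k \<Longrightarrow> y \<in> C k \<Longrightarrow> x < y"
    "\<And>s. s \<subseteq> N k \<Longrightarrow> P s (C k)" for k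
    using f(1)[of k] by (auto simp: I_def N_def C_def split: prod.splits)
  have R: "\<exists>n\<in>C k. N (Suc k) = insert n (N k)" "C (Suc k) \<subseteq> C k" for k
    using f(3)[of k] by (auto simp: R_def N_def C_def split: prod.splits)
  have C_anti: "C j \<subseteq> C i" if "i \<le> j" for i j
    using that R(2) by (rule lift_Suc_antimono_le[rotated])
  have N_mono: "N i \<subseteq> N j" if "i \<le> j" for i j
  proof (rule lift_Suc_mono_le[OF _ that])
    show "N k \<subseteq> N (Suc k)" for k using R(1)[of k] by auto
  qed
  \<comment> \<open>Every point chosen after stage \<open>k\<close> comes from the reservoir of
    stage \<open>k\<close>.\<close>
  have N_C: "N j \<subseteq> N k \<union> C k" for j k
  proof (induction j)
    case 0
    then show ?case using f(2) by (simp add: N_def)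
  next
    case (Suc j)
    show ?case
    proof (cases "Suc j \<le> k")
      case True
      then show ?thesis using N_mono by blast
    next
      case False
      then have "C j \<subseteq> C k" by (intro C_anti) simp
      then show ?thesis using Suc R(1)[of j] by auto
    qed
  qed
  define B where "B = (\<Union>k. N k)"
  have "infinite B"
  proof
    assume "finite B"
    moreover have "card (N k) = k" for k
    proof (induction k)
      case 0
      then show ?case using f(2) by (simp add: N_def)
    next
      case (Suc k)
      obtain n where "n \<in> C k" "N (Suc k) = insert n (N k)" using R(1) by blast
      moreover have "n \<notin> N k" using I(4) calculation(1) by blast
      ultimately show ?case using Suc I(1) by simp
    qed
    ultimately show False
      by (metis B_def UNIV_I UN_upper card_mono Suc_n_not_le_n)
  qed
  moreover have "B \<subseteq> A" using I(2) by (auto simp: B_def)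
  moreover have "P s B" if s: "s \<subseteq> B" "finite s" for s
  proof -
    have "\<exists>k. s \<subseteq> N k"
      using s(2,1)
    proof (induction rule: finite_induct)
      case (insert x s)
      then obtain k j where "s \<subseteq> N k" "x \<in> N j" by (auto simp: B_def)
      then show ?case using N_mono[of k "max k j"] N_mono[of j "max k j"] by auto
    qed simp
    \<comment> \<open>For the least such \<open>k\<close>, the last point of \<open>N k\<close> lies in \<open>s\<close>, so that the points of \<open>B\<close>
      above \<open>s\<close> are all in \<open>C k\<close>.\<close>
    then obtain k where k: "s \<subseteq> N k" "\<And>j. j < k \<Longrightarrow> \<not> s \<subseteq> N j"
      using exists_least_iff[of "\<lambda>k. s \<subseteq> N k"] by auto
    have "{n\<in>B. \<forall>x\<in>s. x < n} \<subseteq> C k"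
    proof
      fix y assume y: "y \<in> {n\<in>B. \<forall>x\<in>s. x < n}"
      have "y \<notin> N k"
      proof (cases k)
        case 0
        then show ?thesis using f(2) by (simp add: N_def)
      next
        case (Suc j)
        obtain n where n: "n \<in> C j" "N k = insert n (N j)" using R(1) Suc by blast
        have "\<not> s \<subseteq> N j" using k(2)[of j] Suc by simp
        then have "n \<in> s" using k(1) by (auto simp: n(2))
        then have "n < y" using y by blast
        moreover have "y \<notin> N j" using n I(4) \<open>n < y\<close> by (meson less_asym)
        ultimately show ?thesis using n by simp
      qed
      then show "y \<in> C k" using y N_C by (auto simp: B_def)
    qed
    then show ?thesis using mono[OF I(5)[OF k(1)]] tail by simp
  qed
  ultimately show ?thesis by blast
qed

section \<open>Combinatorial forcing: accepting and rejecting finite sets\<close>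

definition accepts :: "nat set set \<Rightarrow> nat set \<Rightarrow> nat set \<Rightarrow> bool" where
  "accepts G s A \<longleftrightarrow>
    (\<forall>Y\<subseteq>A. infinite Y \<and> (\<forall>x\<in>s. \<forall>y\<in>Y. x < y) \<longrightarrow> (\<exists>g\<in>G. init_seg g (s \<union> Y)))"

text \<open>Like acceptance, rejection passes to subsets, and every infinite set has an infinite
  subset that accepts or rejects a given \<open>s\<close>.\<close>

definition rejects :: "nat set set \<Rightarrow> nat set \<Rightarrow> nat set \<Rightarrow> bool" where
  "rejects G s A \<longleftrightarrow> (\<forall>B\<subseteq>A. infinite B \<longrightarrow> \<not> accepts G s B)"

lemma accepts_subset: "accepts G s A \<Longrightarrow> B \<subseteq> A \<Longrightarrow> accepts G s B"
  unfolding accepts_def by (meson subset_trans)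

lemma accepts_tail:
  assumes "accepts G s {n\<in>A. \<forall>x\<in>s. x < n}"
  shows "accepts G s A"
  unfolding accepts_def
proof (intro allI impI; elim conjE)
  fix Y assume Y: "Y \<subseteq> A" "infinite Y" "\<forall>x\<in>s. \<forall>y\<in>Y. x < y"
  then have "Y \<subseteq> {n\<in>A. \<forall>x\<in>s. x < n}" by auto
  then show "\<exists>g\<in>G. init_seg g (s \<union> Y)"
    using assms Y(2,3) unfolding accepts_def by simp
qed

lemma rejects_subset: "rejects G s A \<Longrightarrow> B \<subseteq> A \<Longrightarrow> rejects G s B"
  unfolding rejects_def by (meson subset_trans)

lemma infinite_above:
  fixes B :: "nat set"
  assumes "infinite B" "finite s"
  shows "infinite {n\<in>B. \<forall>x\<in>s. x < n}"
proof -
  obtain k where "\<forall>x\<in>s. x < k" using assms(2) finite_nat_set_iff_bounded by blast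
  then have "B - {..<k} \<subseteq> {n\<in>B. \<forall>x\<in>s. x < n}" by (auto simp: not_less intro: less_le_trans)
  moreover have "infinite (B - {..<k})" using assms(1) by simp
  ultimately show ?thesis using finite_subset by blast
qed

text \<open>An infinite subset accepting \<open>s\<close> would still be infinite and accepting
  after cutting off the finitely many points not above \<open>s\<close>.\<close>

lemma rejects_tail:
  assumes "rejects G s {n\<in>A. \<forall>x\<in>s. x < n}" "finite s"
  shows "rejects G s A"
  unfolding rejects_def
proof safe
  fix B assume B: "B \<subseteq> A" "infinite B" "accepts G s B"
  have "accepts G s {n\<in>B. \<forall>x\<in>s. x < n}" by (rule accepts_subset[OF B(3)]) auto
  then show False
    using assms(1) infinite_above[OF B(2) assms(2)] B(1) unfolding rejects_def
    by (elim allE[of _ "{n\<in>B. \<forall>x\<in>s. x < n}"]) auto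
qed

text \<open>Move the least point \<open>n\<close> of a test set \<open>Y\<close> into
  \<open>s\<close>; the rest of \<open>Y\<close> tests \<open>insert n s\<close>. Hence if
  \<open>A\<close> rejects \<open>s\<close>, it accepts \<open>insert n s\<close> for only finitely
  many \<open>n\<close> in \<open>A\<close>.\<close>

lemma accepts_of_accepts_insert:
  assumes "\<And>n. n \<in> B \<Longrightarrow> accepts G (insert n s) A" "B \<subseteq> A"
  shows "accepts G s B"
  unfolding accepts_def
proof (intro allI impI; elim conjE)
  fix Y assume Y: "Y \<subseteq> B" "infinite Y" "\<forall>x\<in>s. \<forall>y\<in>Y. x < y"
  define n where "n = (LEAST n. n \<in> Y)"
  have "Y \<noteq> {}" using Y(2) by auto
  then have n: "n \<in> Y" "\<And>y. y \<in> Y \<Longrightarrow> n \<le> y"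
    unfolding n_def by (auto intro: LeastI Least_le)
  have "accepts G (insert n s) A" using assms(1) n(1) Y(1) by blast
  moreover have "Y - {n} \<subseteq> A" "infinite (Y - {n})" using Y assms(2) by auto
  moreover have "x < y" if "x \<in> insert n s" "y \<in> Y - {n}" for x y
    using that n(2)[of y] Y(3) by auto
  ultimately have "\<exists>g\<in>G. init_seg g (insert n s \<union> (Y - {n}))"
    unfolding accepts_def by metis
  moreover have "insert n s \<union> (Y - {n}) = s \<union> Y" using n by auto
  ultimately show "\<exists>g\<in>G. init_seg g (s \<union> Y)" by simp
qed

text \<open>After shrinking \<open>M\<close> to \<open>A\<close> deciding all its finite subsets,
  either the empty set is accepted, or a further fusion makes rejection spread from the empty set to
  all finite subsets of some \<open>B\<close>; members of \<open>G\<close> are never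
  rejected.\<close>

lemma galvin:
  assumes "infinite M"
  obtains L where "L \<subseteq> M" "infinite L"
    "(\<forall>g\<in>G. finite g \<longrightarrow> \<not> g \<subseteq> L) \<or> (\<forall>Y\<subseteq>L. infinite Y \<longrightarrow> (\<exists>g\<in>G. init_seg g Y))"
proof -
  \<comment> \<open>The second \<open>finite s\<close> belongs to the fused property: its tail
    condition concerns arbitrary \<open>s\<close>, while \<open>rejects_tail\<close> needs
    finiteness.\<close>
  have "\<exists>A\<subseteq>M. infinite A \<and> (\<forall>s\<subseteq>A. finite s \<longrightarrow> finite s \<longrightarrow> accepts G s A \<or> rejects G s A)"
  proof (rule infinite_subset_all_finite_subsets[OF _ _ _ assms])
    fix s B :: "nat set" assume "finite s" "B \<subseteq> M" "infinite B"
    then show "\<exists>C\<subseteq>B. infinite C \<and> (finite s \<longrightarrow> accepts G s C \<or> rejects G s C)"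
      unfolding rejects_def by (meson order_refl)
  next
    fix s A B
    assume "finite s \<longrightarrow> accepts G s A \<or> rejects G s A" "B \<subseteq> A"
    then show "finite s \<longrightarrow> accepts G s B \<or> rejects G s B"
      using accepts_subset rejects_subset by metis
  next
    fix s A
    assume "finite s \<longrightarrow> accepts G s {n\<in>A. \<forall>x\<in>s. x < n} \<or> rejects G s {n\<in>A. \<forall>x\<in>s. x < n}"
    then show "finite s \<longrightarrow> accepts G s A \<or> rejects G s A"
      using accepts_tail[of G s A] rejects_tail[of G s A] by argo
  qed
  then obtain A where A: "A \<subseteq> M" "infinite A"
    and dec: "\<And>s. s \<subseteq> A \<Longrightarrow> finite s \<Longrightarrow> accepts G s A \<or> rejects G s A"
    by blast
  show thesis
  proof (cases "accepts G {} A")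
    case True
    then show ?thesis using A by (intro that[of A]) (auto simp: accepts_def)
  next
    case False
    define P where
      "P s B \<longleftrightarrow> (s \<subseteq> A \<and> rejects G s A \<longrightarrow> (\<forall>n\<in>B. (\<forall>x\<in>s. x < n) \<longrightarrow> rejects G (insert n s) A))"
      for s B
    have "\<exists>B\<subseteq>A. infinite B \<and> (\<forall>s\<subseteq>B. finite s \<longrightarrow> P s B)"
    proof (rule infinite_subset_all_finite_subsets[OF _ _ _ A(2)])
      fix s B :: "nat set" assume s: "finite s" "B \<subseteq> A" "infinite B"
      show "\<exists>C\<subseteq>B. infinite C \<and> P s C"
      proof (cases "s \<subseteq> A \<and> rejects G s A")
        case True
        \<comment> \<open>An infinite \<open>D\<close> would accept \<open>s\<close>, contrary to
          rejection by \<open>A\<close>; so removing the bad points \<open>D\<close> leaves an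
          infinite set.\<close>
        define D where "D = {n\<in>B. accepts G (insert n s) A}"
        have "accepts G s D"
          by (rule accepts_of_accepts_insert[where A = A]) (use s in \<open>auto simp: D_def\<close>)
        moreover have "D \<subseteq> A" using s by (auto simp: D_def)
        ultimately have "finite D" using True unfolding rejects_def by blast
        moreover have "P s (B - D)"
          unfolding P_def
        proof (intro impI ballI)
          fix n assume "s \<subseteq> A \<and> rejects G s A" "n \<in> B - D"
          then show "rejects G (insert n s) A"
            using dec[of "insert n s"] s by (auto simp: D_def)
        qed
        ultimately show ?thesis using s by (intro exI[of _ "B - D"]) auto
      next
        case False
        then show ?thesis using s by (auto simp: P_def)
      qed
    qed (auto simp: P_def)
    then obtain B where B: "B \<subseteq> A" "infinite B" "\<And>s. s \<subseteq> B \<Longrightarrow> finite s \<Longrightarrow> P s B" by blast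
    \<comment> \<open>Elements are added in increasing order, because \<open>P\<close> extends
      rejection only to points above \<open>s\<close>.\<close>
    have rej: "rejects G s A" if "finite s" "s \<subseteq> B" for s
      using that
    proof (induction rule: finite_linorder_max_induct)
      case empty
      then show ?case using False dec[of "{}"] by auto
    next
      case (insert n s)
      then have "P s B" "s \<subseteq> A" using B by auto
      then show ?case using insert unfolding P_def by simp
    qed
    have "\<not> g \<subseteq> B" if "g \<in> G" "finite g" for g
    proof
      assume "g \<subseteq> B"
      have "accepts G g A"
        unfolding accepts_def using that init_seg_Un by (intro allI impI bexI[of _ g]) auto
      then show False
        using rej[OF that(2) \<open>g \<subseteq> B\<close>] A(2) unfolding rejects_def by blast
    qed
    then show ?thesis using A B by (intro that[of B]) auto
  qed
qed

section \<open>The dichotomy for thin families\<close>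

lemma nash_williams:
  assumes "thin T" "infinite M"
  obtains L where "L \<subseteq> M" "infinite L" "T \<inter> Fpow L \<subseteq> F \<or> T \<inter> Fpow L \<inter> F = {}"
proof -
  obtain L where L: "L \<subseteq> M" "infinite L"
    "(\<forall>g\<in>T \<inter> F. finite g \<longrightarrow> \<not> g \<subseteq> L) \<or>
     (\<forall>Y\<subseteq>L. infinite Y \<longrightarrow> (\<exists>g\<in>T \<inter> F. init_seg g Y))"
    using galvin[OF assms(2), of "T \<inter> F"] by blast
  from L(3) have "T \<inter> Fpow L \<subseteq> F \<or> T \<inter> Fpow L \<inter> F = {}"
  proof
    assume ext: "\<forall>Y\<subseteq>L. infinite Y \<longrightarrow> (\<exists>g\<in>T \<inter> F. init_seg g Y)"
    have "t \<in> F" if t: "t \<in> T" "t \<subseteq> L" "finite t" for t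
    proof -
      \<comment> \<open>Adding the tail of \<open>L\<close> above \<open>t\<close> gives an infinite
        subset of \<open>L\<close> with initial segment \<open>t\<close>.\<close>
      let ?X = "{n\<in>L. \<forall>x\<in>t. x < n}"
      have "infinite (t \<union> ?X)" using infinite_above[OF L(2) t(3)] by simp
      moreover have "t \<union> ?X \<subseteq> L" using t by auto
      ultimately obtain g where g: "g \<in> T" "g \<in> F" "init_seg g (t \<union> ?X)" using ext by blast
      moreover have "init_seg t (t \<union> ?X)" using t by (intro init_seg_Un) auto
      ultimately have "g = t"
        using assms(1) t init_seg_comparable unfolding thin_def by blast
      then show ?thesis using g by simp
    qed
    then show ?thesis by (auto simp: Fpow_def)
  qed (auto simp: Fpow_def)
  then show thesis using L that by blast
qed

theorem theoremA:
  fixes fs :: "countable_ordinal \<Rightarrow> nat \<Rightarrow> countable_ordinal"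
    and \<F> :: "nat set set" and M :: "nat set" and \<xi> :: countable_ordinal
  assumes "fundamental_sequences fs"
    and "\<F> \<subseteq> Fpow {1..}"
    and "M \<subseteq> {1..}" and "infinite M"
  shows "\<exists>L\<subseteq>M. infinite L \<and>
    (Schreier_family fs \<xi> \<inter> Fpow L \<subseteq> \<F> \<or>
     Schreier_family fs \<xi> \<inter> Fpow L \<subseteq> Fpow {1..} - \<F>)"
proof -
  obtain L where L: "L \<subseteq> M" "infinite L"
    "Schreier_family fs \<xi> \<inter> Fpow L \<subseteq> \<F> \<or> Schreier_family fs \<xi> \<inter> Fpow L \<inter> \<F> = {}"
    using nash_williams[OF thin_Schreier_family assms(4)] .
  moreover have "Fpow L \<subseteq> Fpow {1..}" using L(1) assms(3) by (auto simp: Fpow_def)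
  ultimately show ?thesis by blast
qed

end
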